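(* Let $a<b$ be real numbers, let $\psi_1,\psi_2,f:\mathbb{R}\to\mathbb{R}$ and $q\in C([a,b],\mathbb{R})$ satisfy the standing hypotheses (i)–(v) listed in the context, and suppose that the equation $$(\psi_{2}((\psi_{1}(u'))'))' + q(x)f(u) = 0$$ has a nontrivial solution $u(x)$ on $[a,b]$ and that there is a point $\xi\in[a,b]$ such that $$u(a)=u(b)=0,\qquad u(x)\neq 0 \text{ for } x\in(a,b),\qquad (\psi_1(u'))'(\xi)=0 .$$ Then $$\int_{a}^{\xi}q_{-}(x)\Phi(u(x))\,dx + \int_{\xi}^{b}q_{+}(x)\Phi(u(x))\,dx > \psi_{2}\left(\frac{\frac{2}{b-a}}{\psi_{1}\left(\frac{b-a}{2}\right)}\right),$$ where $\Phi(s) = \dfrac{f(s)}{\psi_{2}(\psi_{1}(s))}$.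
   Context: Standing hypotheses: (i) $\psi_1$ and $\psi_2$ are odd and (strictly) increasing functions $\mathbb{R}\to\mathbb{R}$; (ii) $\psi_1$ is sub-multiplicative on $[0,\infty)$, i.e. $\psi_1(xy)\le\psi_1(x)\psi_1(y)$ for all $x,y\ge 0$, and $1/\psi_1(s)$ is a convex function for $s>0$; (iii) $\psi_2$ is super-multiplicative on $[0,\infty)$, i.e. $\psi_2(xy)\ge\psi_2(x)\psi_2(y)$ for all $x,y\ge 0$; (iv) $q\in C([a,b],\mathbb{R})$, and $q$ may change sign; (v) $f:\mathbb{R}\to\mathbb{R}$ is odd, continuous and satisfies $sf(s)>0$ for $s\ne 0$. Notation: $q_+(x)=\max\{q(x),0\}$ and $q_-(x)=\max\{-q(x),0\}$. A solution is a real function $u$ such that $u$, $\psi_1(u')$ and $\psi_2((\psi_1(u'))')$ are continuously differentiable and the equation holds pointwise; nontrivial means not identically zero. The function $\Phi(s)$ is defined (and positive) for $s\neq 0$; integrals involving $\Phi(u(x))$ are taken over the points where $u(x)\ne 0$, and are allowed to take the value $+\infty$. *)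

theory Defs
  imports "HOL-Analysis.Analysis"
begin

text \<open>Derivative relative to the interval \<open>[a, b]\<close>: one-sided at the endpoints, two-sided inside.\<close>

definition ivl_deriv :: "real \<Rightarrow> real \<Rightarrow> (real \<Rightarrow> real) \<Rightarrow> real \<Rightarrow> real" where
  "ivl_deriv a b g x = vector_derivative g (at x within {a..b})"

definition C1_ivl :: "real \<Rightarrow> real \<Rightarrow> (real \<Rightarrow> real) \<Rightarrow> bool" where
  "C1_ivl a b g \<longleftrightarrow> g differentiable_on {a..b} \<and> continuous_on {a..b} (ivl_deriv a b g)"

definition quasi_deriv1 ::
  "(real \<Rightarrow> real) \<Rightarrow> real \<Rightarrow> real \<Rightarrow> (real \<Rightarrow> real) \<Rightarrow> real \<Rightarrow> real" where
  "quasi_deriv1 \<psi>1 a b u x = \<psi>1 (ivl_deriv a b u x)"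

definition quasi_deriv2 ::
  "(real \<Rightarrow> real) \<Rightarrow> (real \<Rightarrow> real) \<Rightarrow> real \<Rightarrow> real \<Rightarrow> (real \<Rightarrow> real) \<Rightarrow> real \<Rightarrow> real" where
  "quasi_deriv2 \<psi>1 \<psi>2 a b u x = \<psi>2 (ivl_deriv a b (quasi_deriv1 \<psi>1 a b u) x)"

definition is_solution ::
  "(real \<Rightarrow> real) \<Rightarrow> (real \<Rightarrow> real) \<Rightarrow> (real \<Rightarrow> real) \<Rightarrow> (real \<Rightarrow> real) \<Rightarrow>
    real \<Rightarrow> real \<Rightarrow> (real \<Rightarrow> real) \<Rightarrow> bool" where
  "is_solution \<psi>1 \<psi>2 q f a b u \<longleftrightarrow>
     C1_ivl a b u \<and>
     C1_ivl a b (quasi_deriv1 \<psi>1 a b u) \<and>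
     C1_ivl a b (quasi_deriv2 \<psi>1 \<psi>2 a b u) \<and>
     (\<forall>x\<in>{a..b}. ivl_deriv a b (quasi_deriv2 \<psi>1 \<psi>2 a b u) x + q x * f (u x) = 0)"

text \<open>Only the values at \<open>s \<noteq> 0\<close> are meaningful; the integrals below avoid \<open>s = 0\<close>.\<close>

definition Phi :: "(real \<Rightarrow> real) \<Rightarrow> (real \<Rightarrow> real) \<Rightarrow> (real \<Rightarrow> real) \<Rightarrow> real \<Rightarrow> real" where
  "Phi \<psi>1 \<psi>2 f s = f s / \<psi>2 (\<psi>1 s)"

definition pos_part :: "(real \<Rightarrow> real) \<Rightarrow> real \<Rightarrow> real" where
  "pos_part q x = max (q x) 0"

definition neg_part :: "(real \<Rightarrow> real) \<Rightarrow> real \<Rightarrow> real" where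
  "neg_part q x = max (- q x) 0"

end

theory Submission
  imports Defs
begin

text \<open>
  By oddness of \<open>\<psi>1\<close>, \<open>\<psi>2\<close> and \<open>f\<close> the function \<open>-u\<close> solves the same equation, so let
  \<open>u > 0\<close> on \<open>(a, b)\<close>, with maximum \<open>M = u(c)\<close>. Write \<open>w = (\<psi>1(u'))'\<close>.

  The graph of \<open>u\<close> rises from \<open>0\<close> to \<open>M\<close> and falls back to \<open>0\<close>, so by the mean value theorem
  \<open>u'\<close> takes the values \<open>M / (c - a)\<close> and \<open>-M / (b - c)\<close>, at two points \<open>x1 < x2\<close> of \<open>(a, b)\<close>.
  The quantity \<open>\<psi>1(u')\<close> therefore drops by \<open>\<psi>1(M / (c - a)) + \<psi>1(M / (b - c))\<close>
  between them. Sub-multiplicativity bounds this drop below by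
  \<open>\<psi>1(M) (1 / \<psi>1(c - a) + 1 / \<psi>1(b - c))\<close>, and convexity of \<open>1 / \<psi>1\<close> replaces the unknown
  \<open>c\<close> by the midpoint, giving \<open>2 \<psi>1(M) / \<psi>1((b - a) / 2)\<close>. A second use of the mean value
  theorem, on an interval of length \<open>x2 - x1 < b - a\<close>, produces a point \<open>\<eta>\<close> with
  \<open>-w(\<eta>) > \<psi>1(M) K\<close>, where \<open>K = (2 / (b - a)) / \<psi>1((b - a) / 2)\<close>
  (\<open>steep_quasi_second_derivative\<close>). The strict inequality of the theorem comes from here.

  Super-multiplicativity of \<open>\<psi>2\<close> turns this into \<open>-\<psi>2(w(\<eta>)) > \<psi>2(\<psi>1(M)) \<psi>2(K)\<close>. Since
  \<open>\<psi>2(w)\<close> vanishes at \<open>\<xi>\<close> and has derivative \<open>-q f(u)\<close>, the left side is the integral of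
  \<open>q f(u)\<close> from \<open>\<xi>\<close> to \<open>\<eta>\<close>. If \<open>\<eta>\<close> lies to the right of \<open>\<xi>\<close> only the positive part of \<open>q\<close> can
  make it large, if \<open>\<eta>\<close> lies to the left only the negative part. Finally
  \<open>f(u) / \<psi>2(\<psi>1(M)) \<le> \<Phi>(u)\<close> because \<open>u \<le> M\<close>.
\<close>

section \<open>Calculus on a compact interval\<close>

lemma mean_value_within:
  fixes g g' :: "real \<Rightarrow> real"
  assumes "s < t" and "{s..t} \<subseteq> S"
    and "\<And>x. x \<in> S \<Longrightarrow> (g has_real_derivative g' x) (at x within S)"
  obtains x where "s < x" "x < t" "g t - g s = g' x * (t - s)"
proof -
  have "\<exists>x\<in>{s<..<t}. g t - g s = (*) (g' x) (t - s)"
  proof (rule mvt_simple[OF \<open>s < t\<close>])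
    fix x assume "s \<le> x" "x \<le> t"
    then have "(g has_real_derivative g' x) (at x within S)"
      using assms(2,3) by auto
    then show "(g has_derivative (*) (g' x)) (at x within {s..t})"
      using assms(2) DERIV_subset has_field_derivative_def by blast
  qed
  then show ?thesis using that by auto
qed

lemma nn_integral_positive_variation_ge:
  fixes g g' :: "real \<Rightarrow> real"
  assumes "s \<le> t" and cont: "continuous_on {s..t} g'"
    and deriv: "\<And>x. x \<in> {s..t} \<Longrightarrow> (g has_real_derivative g' x) (at x within {s..t})"
  shows "ennreal (g t - g s) \<le> (\<integral>\<^sup>+ x\<in>{s..t}. ennreal (max (g' x) 0) \<partial>lborel)"
proof -
  have "(g' has_integral (g t - g s)) {s..t}"
    using fundamental_theorem_of_calculus[OF \<open>s \<le> t\<close>, of g g'] deriv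
    by (simp add: has_real_derivative_iff_has_vector_derivative)
  moreover have "continuous_on {s..t} (\<lambda>x. max (g' x) 0)"
    by (intro continuous_intros cont)
  then obtain I where I: "((\<lambda>x. max (g' x) 0) has_integral I) {s..t}"
    using integrable_continuous_real unfolding integrable_on_def by blast
  ultimately have "g t - g s \<le> I"
    by (rule has_integral_le) auto
  then show ?thesis
    using nn_integral_has_integral_lebesgue'[OF _ I] by (simp add: ennreal_leI)
qed

lemma C1_ivl_imp_DERIV:
  assumes "a < b" and "C1_ivl a b g" and "x \<in> {a..b}"
  shows "(g has_real_derivative ivl_deriv a b g x) (at x within {a..b})"
proof -
  have "g differentiable (at x within {a..b})"
    using assms by (auto simp: C1_ivl_def differentiable_on_def)
  then show ?thesis
    by (simp add: ivl_deriv_def has_real_derivative_iff_has_vector_derivative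
        vector_derivative_works)
qed

section \<open>The quasi-derivative of a function vanishing at both endpoints\<close>

text \<open>
  Sub-multiplicativity gives \<open>\<psi> M \<le> \<psi> (M / r) \<psi> r\<close>, and convexity of \<open>1 / \<psi>\<close> at the
  midpoint of \<open>s\<close> and \<open>t\<close> makes the bound depend on \<open>s + t\<close> only.
\<close>

lemma submultiplicative_quotient_sum_ge:
  fixes \<psi> :: "real \<Rightarrow> real"
  assumes pos: "\<And>x. x > 0 \<Longrightarrow> \<psi> x > 0"
    and submult: "\<forall>x\<ge>0. \<forall>y\<ge>0. \<psi> (x * y) \<le> \<psi> x * \<psi> y"
    and conv: "convex_on {0<..} (\<lambda>s. 1 / \<psi> s)"
    and "s > 0" "t > 0" "M > 0"
  shows "\<psi> M * (2 / \<psi> ((s + t) / 2)) \<le> \<psi> (M / s) + \<psi> (M / t)"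
proof -
  have quot: "\<psi> M / \<psi> r \<le> \<psi> (M / r)" if "r > 0" for r
    using submult[rule_format, of "M / r" r] that \<open>M > 0\<close> pos[of r]
    by (simp add: divide_le_eq)
  have "1 / \<psi> ((s + t) / 2) \<le> 1 / 2 * (1 / \<psi> s) + 1 / 2 * (1 / \<psi> t)"
    using convex_onD[OF conv, of "1 / 2" s t] \<open>s > 0\<close> \<open>t > 0\<close>
    by (simp add: add_divide_distrib)
  then have "2 / \<psi> ((s + t) / 2) \<le> 1 / \<psi> s + 1 / \<psi> t"
    by simp
  then have "\<psi> M * (2 / \<psi> ((s + t) / 2)) \<le> \<psi> M * (1 / \<psi> s + 1 / \<psi> t)"
    using pos[OF \<open>M > 0\<close>] by (intro mult_left_mono) auto
  also have "\<dots> = \<psi> M / \<psi> s + \<psi> M / \<psi> t"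
    by (simp add: distrib_left)
  also have "\<dots> \<le> \<psi> (M / s) + \<psi> (M / t)"
    using quot \<open>s > 0\<close> \<open>t > 0\<close> by (intro add_mono) auto
  finally show ?thesis .
qed

text \<open>
  The function climbs to \<open>u c\<close> and descends again inside \<open>(a, b)\<close>, so its slope has to turn
  from a definite positive to a definite negative value. The turning takes place between two
  interior points, which is why the estimate with \<open>1 / (b - a)\<close> is strict.
\<close>

lemma steep_quasi_second_derivative:
  fixes \<psi> u p w :: "real \<Rightarrow> real"
  assumes odd: "\<And>s. \<psi> (- s) = - \<psi> s"
    and pos: "\<And>x. x > 0 \<Longrightarrow> \<psi> x > 0"
    and submult: "\<forall>x\<ge>0. \<forall>y\<ge>0. \<psi> (x * y) \<le> \<psi> x * \<psi> y"
    and conv: "convex_on {0<..} (\<lambda>s. 1 / \<psi> s)"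
    and du: "\<And>x. x \<in> {a..b} \<Longrightarrow> (u has_real_derivative p x) (at x within {a..b})"
    and dv: "\<And>x. x \<in> {a..b} \<Longrightarrow>
      ((\<lambda>x. \<psi> (p x)) has_real_derivative w x) (at x within {a..b})"
    and "u a = 0" "u b = 0" and c: "a < c" "c < b" and "u c > 0"
  obtains \<eta> where "a < \<eta>" "\<eta> < b"
    and "\<psi> (u c) * ((2 / (b - a)) / \<psi> ((b - a) / 2)) < - w \<eta>"
proof -
  obtain x1 where x1: "a < x1" "x1 < c" "u c - u a = p x1 * (c - a)"
    using mean_value_within[of a c "{a..b}" u p] c du by auto
  obtain x2 where x2: "c < x2" "x2 < b" "u b - u c = p x2 * (b - c)"
    using mean_value_within[of c b "{a..b}" u p] c du by auto
  obtain \<eta> where \<eta>: "x1 < \<eta>" "\<eta> < x2" "\<psi> (p x2) - \<psi> (p x1) = w \<eta> * (x2 - x1)"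
  proof (rule mean_value_within[of x1 x2 "{a..b}" "\<lambda>x. \<psi> (p x)" w])
    show "x1 < x2" "{x1..x2} \<subseteq> {a..b}"
      using x1 x2 by auto
  qed (use dv in blast)+
  define T where "T = \<psi> (u c) * (2 / \<psi> ((b - a) / 2))"
  have "T > 0"
    using pos[OF \<open>u c > 0\<close>] pos[of "(b - a) / 2"] c by (simp add: T_def)
  have "p x1 = u c / (c - a)" "p x2 = - (u c / (b - c))"
    using x1 x2 c \<open>u a = 0\<close> \<open>u b = 0\<close> by (auto simp: field_simps)
  moreover have "T \<le> \<psi> (u c / (c - a)) + \<psi> (u c / (b - c))"
    using submultiplicative_quotient_sum_ge[OF pos submult conv, of "c - a" "b - c" "u c"]
      c \<open>u c > 0\<close> by (simp add: T_def)
  ultimately have T: "T \<le> - w \<eta> * (x2 - x1)"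
    using \<eta>(3) odd by simp
  have "T / (b - a) < T / (x2 - x1)"
    using \<open>T > 0\<close> x1 x2 by (intro divide_strict_left_mono) auto
  also have "\<dots> \<le> - w \<eta>"
    using T x1 x2 by (simp add: divide_le_eq)
  finally have "\<psi> (u c) * ((2 / (b - a)) / \<psi> ((b - a) / 2)) < - w \<eta>"
    by (simp add: T_def mult.commute)
  then show ?thesis
    using that[of \<eta>] \<eta> x1 x2 by auto
qed

section \<open>The integral inequality\<close>

lemma odd_strict_mono_pos:
  fixes \<psi> :: "real \<Rightarrow> real"
  assumes "\<forall>s. \<psi> (- s) = - \<psi> s" and "strict_mono \<psi>"
  shows "\<psi> 0 = 0" and "x > 0 \<Longrightarrow> \<psi> x > 0"
proof -
  show "\<psi> 0 = 0"
    using assms(1)[rule_format, of 0] by simp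
  then show "x > 0 \<Longrightarrow> \<psi> x > 0"
    using assms(2) by (metis strict_monoD)
qed

lemma Phi_minus:
  assumes "\<forall>s. \<psi>1 (- s) = - \<psi>1 s" "\<forall>s. \<psi>2 (- s) = - \<psi>2 s" "\<forall>s. f (- s) = - f s"
  shows "Phi \<psi>1 \<psi>2 f (- s) = Phi \<psi>1 \<psi>2 f s"
  using assms by (simp add: Phi_def)

text \<open>
  The equation enters as a first-order system for \<open>u\<close>, \<open>\<psi>1 \<circ> p\<close> and \<open>\<psi>2 \<circ> w\<close>, where \<open>p\<close> and
  \<open>w\<close> are the derivatives of the first two. In this form a negative solution is reduced to a
  positive one by replacing \<open>(u, p, w)\<close> with \<open>(-u, -p, -w)\<close>.
\<close>

lemma positive_solution_integral_bound:
  fixes a b \<xi> :: real and \<psi>1 \<psi>2 f q u p w :: "real \<Rightarrow> real"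
  assumes "a < b"
    and odd1: "\<forall>s. \<psi>1 (- s) = - \<psi>1 s" and mono1: "strict_mono \<psi>1"
    and odd2: "\<forall>s. \<psi>2 (- s) = - \<psi>2 s" and mono2: "strict_mono \<psi>2"
    and submult: "\<forall>x\<ge>0. \<forall>y\<ge>0. \<psi>1 (x * y) \<le> \<psi>1 x * \<psi>1 y"
    and conv: "convex_on {0<..} (\<lambda>s. 1 / \<psi>1 s)"
    and supermult: "\<forall>x\<ge>0. \<forall>y\<ge>0. \<psi>2 (x * y) \<ge> \<psi>2 x * \<psi>2 y"
    and contq: "continuous_on {a..b} q"
    and oddf: "\<forall>s. f (- s) = - f s" and contf: "continuous_on UNIV f"
    and signf: "\<forall>s. s \<noteq> 0 \<longrightarrow> s * f s > 0"
    and du: "\<And>x. x \<in> {a..b} \<Longrightarrow> (u has_real_derivative p x) (at x within {a..b})"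
    and dv: "\<And>x. x \<in> {a..b} \<Longrightarrow>
      ((\<lambda>x. \<psi>1 (p x)) has_real_derivative w x) (at x within {a..b})"
    and dz: "\<And>x. x \<in> {a..b} \<Longrightarrow>
      ((\<lambda>x. \<psi>2 (w x)) has_real_derivative - (q x * f (u x))) (at x within {a..b})"
    and \<xi>: "\<xi> \<in> {a..b}" "w \<xi> = 0"
    and ends: "u a = 0" "u b = 0" and upos: "\<And>x. a < x \<Longrightarrow> x < b \<Longrightarrow> u x > 0"
  shows "(\<integral>\<^sup>+ x\<in>{x\<in>{a..\<xi>}. u x \<noteq> 0}. ennreal (neg_part q x * Phi \<psi>1 \<psi>2 f (u x)) \<partial>lborel)
       + (\<integral>\<^sup>+ x\<in>{x\<in>{\<xi>..b}. u x \<noteq> 0}. ennreal (pos_part q x * Phi \<psi>1 \<psi>2 f (u x)) \<partial>lborel)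
       > ennreal (\<psi>2 ((2 / (b - a)) / \<psi>1 ((b - a) / 2)))"
    (is "?N + ?P > ennreal (\<psi>2 ?K)")
proof -
  note psi1 = odd_strict_mono_pos[OF odd1 mono1] and psi2 = odd_strict_mono_pos[OF odd2 mono2]
  have contu: "continuous_on {a..b} u"
    using du DERIV_continuous_on by blast
  obtain c where c: "c \<in> {a..b}" "\<And>x. x \<in> {a..b} \<Longrightarrow> u x \<le> u c"
    using continuous_attains_sup[OF compact_Icc _ contu] \<open>a < b\<close> by auto
  have "u c > 0"
    using upos[of "(a + b) / 2"] c(2)[of "(a + b) / 2"] \<open>a < b\<close> by auto
  then have "a < c" "c < b"
    using c(1) ends by (auto simp: less_le)
  define D where "D = \<psi>2 (\<psi>1 (u c))"
  have "\<psi>1 (u c) > 0" "D > 0"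
    using psi1(2) psi2(2) \<open>u c > 0\<close> by (auto simp: D_def)
  have "?K > 0"
    using psi1(2)[of "(b - a) / 2"] \<open>a < b\<close> by simp
  obtain \<eta> where \<eta>: "a < \<eta>" "\<eta> < b" and steep: "\<psi>1 (u c) * ?K < - w \<eta>"
    using steep_quasi_second_derivative[OF odd1[rule_format] psi1(2) submult conv du dv ends
        \<open>a < c\<close> \<open>c < b\<close> \<open>u c > 0\<close>] by blast
  have "D * \<psi>2 ?K \<le> \<psi>2 (\<psi>1 (u c) * ?K)"
    unfolding D_def
    using supermult[rule_format, of "\<psi>1 (u c)" ?K] \<open>\<psi>1 (u c) > 0\<close> \<open>?K > 0\<close> by linarith
  also have "\<dots> < \<psi>2 (- w \<eta>)"
    using mono2 steep by (rule strict_monoD)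
  finally have "\<psi>2 ?K < - \<psi>2 (w \<eta>) / D"
    by (simp only: odd2[rule_format] pos_less_divide_eq[OF \<open>D > 0\<close>] mult.commute)
  then have strict: "ennreal (\<psi>2 ?K) < ennreal (- \<psi>2 (w \<eta>) / D)"
    using psi2(2)[OF \<open>?K > 0\<close>] by (simp add: ennreal_less_iff)
  have f_nonneg: "f s \<ge> 0" if "s \<ge> 0" for s
    using signf oddf[rule_format, of 0] that by (cases "s = 0") (auto simp: zero_less_mult_iff)
  have f_zero: "f 0 = 0"
    using oddf[rule_format, of 0] by simp
  have u_nonneg: "u x \<ge> 0" if "x \<in> {a..b}" for x
    using upos[of x] ends that by (cases "x = a \<or> x = b") (auto simp: less_le)
  have Phi_ge: "f (u x) / D \<le> Phi \<psi>1 \<psi>2 f (u x)" if "x \<in> {a..b}" "u x \<noteq> 0" for x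
  proof -
    have "u x > 0" using u_nonneg that by fastforce
    then have "\<psi>2 (\<psi>1 (u x)) > 0" using psi1(2) psi2(2) by simp
    moreover have "\<psi>2 (\<psi>1 (u x)) \<le> D"
      using c(2)[OF that(1)] mono1 mono2 by (simp add: D_def strict_mono_less_eq)
    ultimately show ?thesis
      using f_nonneg[of "u x"] \<open>u x > 0\<close> \<open>D > 0\<close>
      by (auto simp: Phi_def intro!: divide_left_mono)
  qed
  have contqf: "continuous_on {a..b} (\<lambda>x. q x * f (u x) / D)"
    using continuous_on_compose2[OF contf contu] \<open>D > 0\<close>
    by (intro continuous_on_divide continuous_on_mult contq continuous_on_const) auto
  \<comment> \<open>The sign \<open>\<epsilon>\<close> is \<open>1\<close> on the right of \<open>\<xi>\<close> and \<open>-1\<close> on the left, so that one computation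
      serves both positions of \<open>\<eta>\<close>.\<close>
  have side: "ennreal (- \<epsilon> * (\<psi>2 (w t) - \<psi>2 (w s)) / D) \<le>
      (\<integral>\<^sup>+ x\<in>{x\<in>J. u x \<noteq> 0}. ennreal (max (\<epsilon> * q x) 0 * Phi \<psi>1 \<psi>2 f (u x)) \<partial>lborel)"
    if "s \<le> t" "{s..t} \<subseteq> J" "J \<subseteq> {a..b}" for \<epsilon> s t and J :: "real set"
  proof -
    have sub: "{s..t} \<subseteq> {a..b}" using that by blast
    have "ennreal (- \<epsilon> * \<psi>2 (w t) / D - - \<epsilon> * \<psi>2 (w s) / D) \<le>
        (\<integral>\<^sup>+ x\<in>{s..t}. ennreal (max (\<epsilon> * (q x * f (u x) / D)) 0) \<partial>lborel)"
    proof (rule nn_integral_positive_variation_ge[OF \<open>s \<le> t\<close>])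
      show "continuous_on {s..t} (\<lambda>x. \<epsilon> * (q x * f (u x) / D))"
        by (intro continuous_on_mult continuous_on_const continuous_on_subset[OF contqf sub])
      fix x assume "x \<in> {s..t}"
      then have "((\<lambda>x. \<psi>2 (w x)) has_real_derivative - (q x * f (u x))) (at x within {s..t})"
        using dz sub DERIV_subset by blast
      then show "((\<lambda>x. - \<epsilon> * \<psi>2 (w x) / D) has_real_derivative \<epsilon> * (q x * f (u x) / D))
          (at x within {s..t})"
        using \<open>D > 0\<close> by (auto intro!: derivative_eq_intros)
    qed
    also have "\<dots> \<le>
      (\<integral>\<^sup>+ x\<in>{x\<in>J. u x \<noteq> 0}. ennreal (max (\<epsilon> * q x) 0 * Phi \<psi>1 \<psi>2 f (u x)) \<partial>lborel)"
    proof (rule nn_integral_mono)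
      fix x :: real
      show "ennreal (max (\<epsilon> * (q x * f (u x) / D)) 0) * indicator {s..t} x \<le>
        ennreal (max (\<epsilon> * q x) 0 * Phi \<psi>1 \<psi>2 f (u x)) * indicator {x\<in>J. u x \<noteq> 0} x"
      proof (cases "x \<in> {s..t} \<and> u x \<noteq> 0")
        case True
        then have x: "x \<in> {a..b}" "x \<in> J" using sub that by auto
        have "f (u x) / D \<ge> 0"
          using f_nonneg u_nonneg x(1) \<open>D > 0\<close> by simp
        then have "max (\<epsilon> * (q x * f (u x) / D)) 0 = max (\<epsilon> * q x) 0 * (f (u x) / D)"
          using max_mult_distrib_right[of "\<epsilon> * q x" 0 "f (u x) / D"] by simp
        also have "\<dots> \<le> max (\<epsilon> * q x) 0 * Phi \<psi>1 \<psi>2 f (u x)"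
          using Phi_ge x(1) True by (intro mult_left_mono) auto
        finally show ?thesis
          using True x by (simp add: ennreal_leI)
      next
        case False
        then show ?thesis using f_zero by (auto simp: indicator_def)
      qed
    qed
    finally show ?thesis
      by (simp add: right_diff_distrib diff_divide_distrib)
  qed
  have z\<xi>: "\<psi>2 (w \<xi>) = 0"
    using \<xi>(2) psi2(1) by simp
  have "ennreal (- \<psi>2 (w \<eta>) / D) \<le> ?N + ?P"
  proof (cases "\<xi> \<le> \<eta>")
    case True
    then have "ennreal (- \<psi>2 (w \<eta>) / D) \<le> ?P"
      using side[of \<xi> \<eta> "{\<xi>..b}" 1] \<eta> \<xi> z\<xi> by (auto simp: pos_part_def)
    then show ?thesis by (simp add: add_increasing)
  next
    case False
    then have "ennreal (- \<psi>2 (w \<eta>) / D) \<le> ?N"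
      using side[of \<eta> \<xi> "{a..\<xi>}" "- 1"] \<eta> \<xi> z\<xi> by (auto simp: neg_part_def)
    then show ?thesis by (simp add: add_increasing2)
  qed
  with strict show ?thesis by (rule less_le_trans)
qed

text \<open>
  A continuous function without zeros on \<open>(a, b)\<close> has constant sign there, so either the
  solution or its negative is covered by the positive case; the integrands are the same for
  both because \<open>\<Phi>\<close> is even.
\<close>

theorem theorem2p1:
  fixes a b \<xi> :: real and \<psi>1 \<psi>2 f q u :: "real \<Rightarrow> real"
  assumes "a < b"
    and "\<forall>s. \<psi>1 (- s) = - \<psi>1 s" and "strict_mono \<psi>1"
    and "\<forall>s. \<psi>2 (- s) = - \<psi>2 s" and "strict_mono \<psi>2"
    and "\<forall>x\<ge>0. \<forall>y\<ge>0. \<psi>1 (x * y) \<le> \<psi>1 x * \<psi>1 y"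
    and "convex_on {0<..} (\<lambda>s. 1 / \<psi>1 s)"
    and "\<forall>x\<ge>0. \<forall>y\<ge>0. \<psi>2 (x * y) \<ge> \<psi>2 x * \<psi>2 y"
    and "continuous_on {a..b} q"
    and "\<forall>s. f (- s) = - f s" and "continuous_on UNIV f" and "\<forall>s. s \<noteq> 0 \<longrightarrow> s * f s > 0"
    and "is_solution \<psi>1 \<psi>2 q f a b u"
    and "\<exists>x\<in>{a..b}. u x \<noteq> 0"
    and "\<xi> \<in> {a..b}"
    and "u a = 0" and "u b = 0" and "\<forall>x\<in>{a<..<b}. u x \<noteq> 0"
    and "ivl_deriv a b (quasi_deriv1 \<psi>1 a b u) \<xi> = 0"
  shows "(\<integral>\<^sup>+ x\<in>{x\<in>{a..\<xi>}. u x \<noteq> 0}. ennreal (neg_part q x * Phi \<psi>1 \<psi>2 f (u x)) \<partial>lborel)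
       + (\<integral>\<^sup>+ x\<in>{x\<in>{\<xi>..b}. u x \<noteq> 0}. ennreal (pos_part q x * Phi \<psi>1 \<psi>2 f (u x)) \<partial>lborel)
       > ennreal (\<psi>2 ((2 / (b - a)) / \<psi>1 ((b - a) / 2)))"
proof -
  note hyps = assms(1-12)
  define p where "p = ivl_deriv a b u"
  define w where "w = ivl_deriv a b (quasi_deriv1 \<psi>1 a b u)"
  have v_eq: "quasi_deriv1 \<psi>1 a b u = (\<lambda>x. \<psi>1 (p x))"
    and z_eq: "quasi_deriv2 \<psi>1 \<psi>2 a b u = (\<lambda>x. \<psi>2 (w x))"
    by (auto simp: quasi_deriv1_def quasi_deriv2_def p_def w_def)
  have du: "(u has_real_derivative p x) (at x within {a..b})"
    and dv: "((\<lambda>x. \<psi>1 (p x)) has_real_derivative w x) (at x within {a..b})"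
    and dz: "((\<lambda>x. \<psi>2 (w x)) has_real_derivative - (q x * f (u x))) (at x within {a..b})"
    if "x \<in> {a..b}" for x
  proof -
    have C1: "C1_ivl a b u" "C1_ivl a b (quasi_deriv1 \<psi>1 a b u)"
        "C1_ivl a b (quasi_deriv2 \<psi>1 \<psi>2 a b u)"
      and "ivl_deriv a b (quasi_deriv2 \<psi>1 \<psi>2 a b u) x = - (q x * f (u x))"
      using assms(13) that by (auto simp: is_solution_def eq_neg_iff_add_eq_0)
    then show "(u has_real_derivative p x) (at x within {a..b})"
      "((\<lambda>x. \<psi>1 (p x)) has_real_derivative w x) (at x within {a..b})"
      "((\<lambda>x. \<psi>2 (w x)) has_real_derivative - (q x * f (u x))) (at x within {a..b})"
      using C1_ivl_imp_DERIV[OF \<open>a < b\<close> C1(1) that] C1_ivl_imp_DERIV[OF \<open>a < b\<close> C1(2) that]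
        C1_ivl_imp_DERIV[OF \<open>a < b\<close> C1(3) that]
      by (simp_all add: p_def[symmetric] w_def[symmetric] v_eq[symmetric] z_eq[symmetric])
  qed
  have w\<xi>: "w \<xi> = 0"
    using assms(19) by (simp add: w_def)
  have contu: "continuous_on {a<..<b} u"
    using DERIV_continuous_on[OF du] by (rule continuous_on_subset) auto
  have conn: "connected (u ` {a<..<b})"
    by (rule connected_continuous_image[OF contu]) simp
  have "(\<forall>x\<in>{a<..<b}. u x > 0) \<or> (\<forall>x\<in>{a<..<b}. u x < 0)"
  proof (rule ccontr)
    assume "\<not> ?thesis"
    then obtain x y where "x \<in> {a<..<b}" "u x \<le> 0" "y \<in> {a<..<b}" "0 \<le> u y"
      by (auto simp: not_less)
    then have "0 \<in> u ` {a<..<b}"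
      using connectedD_interval[OF conn, of "u x" "u y" 0] by blast
    then show False using assms(18) by auto
  qed
  then show ?thesis
  proof
    assume "\<forall>x\<in>{a<..<b}. u x > 0"
    then show ?thesis
      using positive_solution_integral_bound[OF hyps du dv dz assms(15) w\<xi> assms(16,17)] by auto
  next
    assume neg: "\<forall>x\<in>{a<..<b}. u x < 0"
    have "((\<lambda>x. - u x) has_real_derivative - p x) (at x within {a..b})"
      "((\<lambda>x. \<psi>1 (- p x)) has_real_derivative - w x) (at x within {a..b})"
      "((\<lambda>x. \<psi>2 (- w x)) has_real_derivative - (q x * f (- u x))) (at x within {a..b})"
      if "x \<in> {a..b}" for x
      using DERIV_minus[OF du[OF that]] DERIV_minus[OF dv[OF that]] DERIV_minus[OF dz[OF that]]
        assms(2,4,10) by simp_all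
    from positive_solution_integral_bound[OF hyps this assms(15)] show ?thesis
      using neg w\<xi> assms(16,17) Phi_minus[OF assms(2,4,10)] by simp
  qed
qed

end
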